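(* Let $\sigma$ be an s-finite kernel from a measurable space $S$ to a standard Borel space $T$. Then there exists a measurable partial function $d:S\times\mathbb{R}\rightharpoonup T$ such that, for all $s\in S$, $$\sigma(s)=d(s,-)_*\big(\mathbb{U}_{\mathbb{R}}\big).$$ Conversely, any kernel from $S$ to $T$ obtained in this way from a measurable partial function $d:S\times\mathbb{R}\rightharpoonup T$ is s-finite.
   Context: A kernel from a measurable space $S$ to a measurable space $T$ is a map $\sigma:S\times\Sigma_T\to[0,\infty]$ that is measurable in its first argument and a measure in its second; $\sigma(s)$ denotes the measure $\sigma(s,-)$. It is finite if $\sup_{s}\sigma(s,T)<\infty$, and s-finite if it is a countable sum of finite kernels from $S$ to $T$. A measurable partial function $X\rightharpoonup Y$ is a measurable function $X\to Y+\{\bot\}$ (undefined where the value is $\bot$). The pushforward of a measure $m$ on $X$ along a measurable partial function $h:X\rightharpoonup Y$ is $(h_*m)(U)=m(\{x\mid h(x)\in U\})$ for $U\in\Sigma_Y$ (mass sent to $\bot$ is discarded). $\mathbb{U}_{\mathbb{R}}$ is the Lebesgue measure on $\mathbb{R}$ (with its Borel $\sigma$-algebra). A standard Borel space is a set with the Borel $\sigma$-algebra of some complete separable metric. *)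

theory Defs
  imports "HOL-Analysis.Analysis"
begin

definition standard_borel :: "'a measure \<Rightarrow> bool" where
  "standard_borel M \<longleftrightarrow>
     (\<exists>d. Metric_space (space M) d \<and>
          Metric_space.mcomplete (space M) d \<and>
          separable_space (Metric_space.mtopology (space M) d) \<and>
          sets M = sigma_sets (space M) {U. openin (Metric_space.mtopology (space M) d) U})"

text \<open>
  A kernel is rendered as a measure-valued function; its values outside
  the underlying set of \<open>S\<close> are irrelevant.
\<close>

definition is_kernel :: "'s measure \<Rightarrow> 't measure \<Rightarrow> ('s \<Rightarrow> 't measure) \<Rightarrow> bool" where
  "is_kernel S T \<kappa> \<longleftrightarrow>
     (\<forall>s\<in>space S. sets (\<kappa> s) = sets T) \<and>
     (\<forall>U\<in>sets T. (\<lambda>s. emeasure (\<kappa> s) U) \<in> borel_measurable S)"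

definition finite_kernel :: "'s measure \<Rightarrow> 't measure \<Rightarrow> ('s \<Rightarrow> 't measure) \<Rightarrow> bool" where
  "finite_kernel S T \<kappa> \<longleftrightarrow>
     is_kernel S T \<kappa> \<and> (SUP s\<in>space S. emeasure (\<kappa> s) (space T)) < \<infinity>"

text \<open>
  Finite sums are covered by the sequences below, since the zero kernel is finite.
\<close>

definition s_finite_kernel :: "'s measure \<Rightarrow> 't measure \<Rightarrow> ('s \<Rightarrow> 't measure) \<Rightarrow> bool" where
  "s_finite_kernel S T \<kappa> \<longleftrightarrow>
     is_kernel S T \<kappa> \<and>
     (\<exists>k :: nat \<Rightarrow> 's \<Rightarrow> 't measure.
        (\<forall>i. finite_kernel S T (k i)) \<and>
        (\<forall>s\<in>space S. \<forall>U\<in>sets T. emeasure (\<kappa> s) U = (\<Sum>i. emeasure (k i s) U)))"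

text \<open>
  The coproduct of \<open>M\<close> with a one-point space, the extra point \<open>\<bottom>\<close> being \<^const>\<open>None\<close>.
  A measurable partial function from \<open>X\<close> to \<open>Y\<close> is an element of
  \<^term>\<open>measurable X (option_space Y)\<close>.
\<close>

definition option_space :: "'a measure \<Rightarrow> 'a option measure" where
  "option_space M =
     sigma (insert None (Some ` space M))
       {A. A \<subseteq> insert None (Some ` space M) \<and> Some -` A \<in> sets M}"

lemma space_option_space: "space (option_space M) = insert None (Some ` space M)"
  unfolding option_space_def by (rule space_measure_of) auto

lemma sets_option_space:
  "sets (option_space M) = {A. A \<subseteq> insert None (Some ` space M) \<and> Some -` A \<in> sets M}"
proof -
  let ?O = "insert None (Some ` space M)"
  let ?A = "{A. A \<subseteq> ?O \<and> Some -` A \<in> sets M}"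
  have "sigma_algebra ?O ?A"
    unfolding sigma_algebra_iff2
  proof (intro conjI ballI allI impI)
    fix A assume "A \<in> ?A"
    moreover have "Some -` (?O - A) = space M - Some -` A" by auto
    ultimately show "?O - A \<in> ?A" by auto
  next
    fix A :: "nat \<Rightarrow> 'a option set" assume "range A \<subseteq> ?A"
    then show "(\<Union>i. A i) \<in> ?A" by (auto simp: vimage_UN)
  qed auto
  then show ?thesis
    unfolding option_space_def
    by (subst sets_measure_of) (auto simp: sigma_algebra.sigma_sets_eq)
qed

definition pushforward_partial ::
    "'a measure \<Rightarrow> 'b measure \<Rightarrow> ('a \<Rightarrow> 'b option) \<Rightarrow> 'b measure" where
  "pushforward_partial m Y h =
     measure_of (space Y) (sets Y) (\<lambda>U. emeasure m {x \<in> space m. h x \<in> Some ` U})"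

lemma space_pushforward_partial [simp]: "space (pushforward_partial m Y h) = space Y"
  and sets_pushforward_partial [simp]: "sets (pushforward_partial m Y h) = sets Y"
  unfolding pushforward_partial_def by (simp_all add: sets.space_closed)

text \<open>
  \<^const>\<open>measure_of\<close> yields the zero measure when its argument is not countably additive;
  this does not happen for a measurable partial function.
\<close>

lemma emeasure_pushforward_partial:
  assumes h: "h \<in> measurable m (option_space Y)" and U: "U \<in> sets Y"
  shows "emeasure (pushforward_partial m Y h) U = emeasure m {x \<in> space m. h x \<in> Some ` U}"
proof (rule emeasure_measure_of[OF pushforward_partial_def])
  let ?\<mu> = "\<lambda>U. emeasure m {x \<in> space m. h x \<in> Some ` U}"
  have meas: "{x \<in> space m. h x \<in> Some ` V} \<in> sets m" if "V \<in> sets Y" for V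
  proof -
    have "Some ` V \<in> sets (option_space Y)"
      using that sets.sets_into_space[OF that]
      by (auto simp: sets_option_space inj_vimage_image_eq)
    from measurable_sets[OF h this] show ?thesis
      by (simp add: vimage_def Int_def conj_commute)
  qed
  show "countably_additive (sets (pushforward_partial m Y h)) ?\<mu>"
  proof (rule countably_additiveI)
    fix A :: "nat \<Rightarrow> 'b set"
    assume A: "range A \<subseteq> sets (pushforward_partial m Y h)" and dj: "disjoint_family A"
    let ?B = "\<lambda>i. {x \<in> space m. h x \<in> Some ` A i}"
    have "(\<Sum>i. emeasure m (?B i)) = emeasure m (\<Union>i. ?B i)"
    proof (rule suminf_emeasure)
      show "range ?B \<subseteq> sets m" using A meas by auto
      show "disjoint_family ?B" using dj by (fastforce simp: disjoint_family_on_def)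
    qed
    also have "(\<Union>i. ?B i) = {x \<in> space m. h x \<in> Some ` (\<Union>i. A i)}" by auto
    finally show "(\<Sum>i. ?\<mu> (A i)) = ?\<mu> (\<Union>i. A i)" .
  qed
qed (use U in \<open>auto simp: positive_def sets.space_closed\<close>)

end

theory Submission
  imports Defs "HOL-Probability.Weak_Convergence"
begin

text \<open>
  A nonempty standard Borel space \<open>T\<close> is a measurable retract of the real line, so a finite kernel to \<open>T\<close>
  can be pushed to a kernel of finite measures on the reals, sampled there by the quantile function
  on the interval \<open>(0, \<sigma>(s, T))\<close>, and pulled back along the retraction. The summands of an s-finite
  kernel are bounded in mass by constants, so their sampling intervals can be placed side by side
  at offsets that do not depend on \<open>s\<close>. Conversely, cutting the real line into countably many
  bounded pieces splits a pushforward of Lebesgue measure into finite kernels.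
\<close>

section \<open>Standard Borel spaces as measurable retracts of the real line\<close>

text \<open>Using only the digits 0 and 1 in base 4 rules out carries: after scaling by
  \<open>4 ^ m\<close>, the digits beyond position \<open>m\<close> add up to at most 1/3, and those
  before it to a multiple of 4. So the parity of the floor is the bit. In base 2 a tail of ones
  would carry.\<close>

lemma odd_floor_base4_digit:
  fixes b :: "nat \<Rightarrow> bool"
  shows "odd \<lfloor>4 ^ m * (\<Sum>k. of_bool (b k) / 4 ^ k :: real)\<rfloor> \<longleftrightarrow> b m"
proof -
  define c :: "nat \<Rightarrow> real" where "c k = of_bool (b k) / 4 ^ k" for k
  define N where "N = (\<Sum>k<m. of_bool (b k) * 4 ^ (m - k) :: int)"
  define R where "R = 4 ^ m * (\<Sum>k. c (k + Suc m))"
  have c_le: "c k \<le> (1/4) ^ k" and c_nonneg: "0 \<le> c k" for k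
    by (auto simp: c_def field_simps)
  have c: "summable c"
    by (rule summable_comparison_test[where g="\<lambda>k. (1/4) ^ k"])
       (use c_le c_nonneg in \<open>auto intro!: summable_geometric\<close>)
  have tail: "summable (\<lambda>k. c (k + Suc m))"
    using c by (rule summable_ignore_initial_segment)
  have "(\<Sum>k. c (k + Suc m)) \<le> (\<Sum>k. (1/4) ^ Suc m * (1/4) ^ k)"
    by (intro suminf_le tail summable_mult summable_geometric)
       (use c_le[of "_ + Suc m"] in \<open>auto simp: power_add mult_ac\<close>)
  also have "\<dots> = (1/4) ^ Suc m * (4/3)"
    by (subst suminf_mult) (auto simp: suminf_geometric intro!: summable_geometric)
  finally have "R \<le> 4 ^ m * ((1/4) ^ Suc m * (4/3))"
    unfolding R_def by (intro mult_left_mono) auto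
  then have R: "0 \<le> R" "R < 1"
    using suminf_nonneg[OF tail c_nonneg] by (auto simp: R_def power_divide)
  have "4 ^ m * c k = of_int (of_bool (b k) * 4 ^ (m - k))" if "k < m" for k
    using less_imp_add_positive[OF that] by (auto simp: c_def power_add)
  then have "4 ^ m * (\<Sum>k<m. c k) = of_int N"
    by (simp add: N_def sum_distrib_left)
  moreover have "4 ^ m * c m = of_int (of_bool (b m))"
    by (simp add: c_def)
  moreover have "(\<Sum>k. c k) = (\<Sum>k. c (k + Suc m)) + (\<Sum>k<m. c k) + c m"
    using suminf_split_initial_segment[OF c, of "Suc m"] by simp
  ultimately have "4 ^ m * (\<Sum>k. c k) = of_int (N + of_bool (b m)) + R"
    by (simp add: R_def algebra_simps)
  then have "\<lfloor>4 ^ m * (\<Sum>k. c k)\<rfloor> = N + of_bool (b m)"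
    using R by linarith
  moreover have "even N"
    unfolding N_def by (intro dvd_sum) auto
  ultimately show ?thesis
    by (simp add: c_def)
qed

lemma (in Metric_space) tendsto_mdist:
  assumes "limitin mtopology u l F" "p \<in> M"
  shows "((\<lambda>x. d p (u x)) \<longlongrightarrow> d p l) F"
proof -
  have l: "l \<in> M" "eventually (\<lambda>x. u x \<in> M) F" "((\<lambda>x. d (u x) l) \<longlongrightarrow> 0) F"
    using assms(1) by (auto simp: limitin_metric_dist_null)
  have "((\<lambda>x. d p (u x) - d p l) \<longlongrightarrow> 0) F"
  proof (rule Lim_null_comparison[OF _ l(3)])
    show "eventually (\<lambda>x. norm (d p (u x) - d p l) \<le> d (u x) l) F"
      using l(2)
    proof eventually_elim
      case (elim x)
      show ?case
        using mdist_reverse_triangle[OF elim assms(2) l(1)] by (simp add: commute)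
    qed
  qed
  then show ?thesis
    by (simp add: LIM_zero_iff)
qed

text \<open>An explicit countable base: if \<open>1 / 2 ^ n < r / 2\<close>, a centre within
  \<open>1 / 2 ^ n\<close> of \<open>x\<close> has its ball of that radius inside
  \<open>mball x r\<close>.\<close>

lemma (in Metric_space) dense_ball_in_open:
  assumes p: "\<And>x r. x \<in> M \<Longrightarrow> 0 < r \<Longrightarrow> \<exists>i::nat. p i \<in> mball x r"
    and U: "openin mtopology U" "x \<in> U"
  shows "\<exists>i n. x \<in> mball (p i) (1 / 2 ^ n) \<and> mball (p i) (1 / 2 ^ n) \<subseteq> U"
proof -
  obtain r where r: "r > 0" "mball x r \<subseteq> U" and x: "x \<in> M"
    using U openin_mtopology by blast
  obtain n where n: "1 / 2 ^ n < r / 2"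
    using real_arch_pow_inv[of "r/2" "1/2"] r(1) by (auto simp: power_one_over)
  obtain i where i: "p i \<in> mball x (1 / 2 ^ n)"
    using p[OF x, of "1 / 2 ^ n"] by auto
  have "mball (p i) (1 / 2 ^ n) \<subseteq> mball x r"
    using i n triangle[of x "p i"] by fastforce
  with i r show ?thesis
    by (intro exI[of _ i] exI[of _ n]) (auto simp: commute)
qed

text \<open>An open set is a countable union of dyadic balls around the dense sequence, and the
  preimage of such a ball is a strict sublevel set of a distance function. This reduces
  measurability into \<open>T\<close> to that of real-valued functions.\<close>

lemma measurable_metric_borelI:
  fixes T :: "'t measure" and p :: "nat \<Rightarrow> 't"
  assumes "Metric_space (space T) d"
    and sets_T: "sets T = sigma_sets (space T) {U. openin (Metric_space.mtopology (space T) d) U}"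
    and p: "\<And>x r. x \<in> space T \<Longrightarrow> 0 < r \<Longrightarrow> \<exists>i. p i \<in> Metric_space.mball (space T) d x r"
    and pT: "\<And>i. p i \<in> space T"
    and g: "\<And>x. x \<in> space X \<Longrightarrow> g x \<in> space T"
    and d: "\<And>i. (\<lambda>x. d (p i) (g x)) \<in> borel_measurable X"
  shows "g \<in> measurable X T"
proof (rule measurable_sigma_sets[OF sets_T])
  interpret Metric_space "space T" d by fact
  show "{U. openin mtopology U} \<subseteq> Pow (space T)"
    using openin_subset by fastforce
  show "g \<in> space X \<rightarrow> space T"
    using g by auto
  fix U assume "U \<in> {U. openin mtopology U}"
  then have U: "openin mtopology U" by simp
  define I where "I = {(i, n). mball (p i) (1 / 2 ^ n) \<subseteq> U}"
  have "g -` U \<inter> space X = (\<Union>(i,n)\<in>I. {x \<in> space X. d (p i) (g x) < 1 / 2 ^ n})"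
  proof (intro equalityI subsetI)
    fix x assume "x \<in> g -` U \<inter> space X"
    with dense_ball_in_open[of p U "g x", OF p U]
    show "x \<in> (\<Union>(i,n)\<in>I. {x \<in> space X. d (p i) (g x) < 1 / 2 ^ n})"
      by (fastforce simp: I_def)
  next
    fix x assume "x \<in> (\<Union>(i,n)\<in>I. {x \<in> space X. d (p i) (g x) < 1 / 2 ^ n})"
    then show "x \<in> g -` U \<inter> space X"
      using pT g by (fastforce simp: I_def)
  qed
  also have "\<dots> \<in> sets X"
    using d by (intro sets.countable_UN') (auto split: prod.splits)
  finally show "g -` U \<inter> space X \<in> sets X" .
qed

text \<open>
  A point is coded by the balls \<open>B (p i) (1 / 2 ^ n)\<close> around a dense sequence that contain it,
  the bits being stored in the base 4 digits of a real number. Decoding reads off, for each \<open>n\<close>, the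
  first ball of radius \<open>1 / 2 ^ n\<close> and takes the limit of the centres. By completeness this is
  measurable, and so there is no need to know that the range of the code is a Borel set.
\<close>
lemma standard_borel_retract_real:
  fixes T :: "'t measure"
  assumes "standard_borel T" "space T \<noteq> {}"
  shows "\<exists>f \<in> borel_measurable T. \<exists>g \<in> measurable (borel :: real measure) T.
           \<forall>t\<in>space T. g (f t) = t"
proof -
  obtain d where "Metric_space (space T) d"
    and compl: "Metric_space.mcomplete (space T) d"
    and sep: "separable_space (Metric_space.mtopology (space T) d)"
    and sets_T: "sets T = sigma_sets (space T) {U. openin (Metric_space.mtopology (space T) d) U}"
    using assms unfolding standard_borel_def by auto
  then interpret Metric_space "space T" d by simp
  obtain C where C: "countable C" "C \<subseteq> space T" "mtopology closure_of C = space T"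
    using sep unfolding separable_space_def by auto
  then have "C \<noteq> {}"
    using assms(2) by auto
  define p where "p = from_nat_into C"
  have pT[simp]: "p i \<in> space T" for i
    using from_nat_into[OF \<open>C \<noteq> {}\<close>] C(2) by (auto simp: p_def)
  have dense: "\<exists>i. p i \<in> mball x r" if r: "x \<in> space T" "0 < r" for x r
  proof -
    have "x \<in> mtopology closure_of C"
      using r C(3) by simp
    then obtain c where "c \<in> C" "c \<in> mball x r"
      using r(2) unfolding metric_closure_of by blast
    then show ?thesis
      using from_nat_into_surj[OF C(1)] by (metis p_def)
  qed
  \<comment> \<open>\<open>prod_decode\<close> reads \<open>k\<close> as a pair of a centre index
    and a radius exponent, so one sequence of bits records membership in all the balls.\<close>
  define ball where "ball k = mball (p (fst (prod_decode k))) (1 / 2 ^ snd (prod_decode k))" for k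
  have [measurable]: "ball k \<in> sets T" for k
    unfolding ball_def sets_T using openin_mball by blast
  define f :: "'t \<Rightarrow> real" where "f t = (\<Sum>k. of_bool (t \<in> ball k) / 4 ^ k)" for t
  have f: "f \<in> borel_measurable T"
    unfolding f_def by measurable
  \<comment> \<open>For a \<open>y\<close> that codes no point there may be no odd digit to find;
    the value is then an unspecified index, which is harmless since every \<open>p i\<close> lies in
    \<open>T\<close>.\<close>
  define idx :: "nat \<Rightarrow> real \<Rightarrow> nat"
    where "idx n y = (LEAST i. odd \<lfloor>4 ^ prod_encode (i, n) * y\<rfloor>)" for n y
  define u where "u y n = p (idx n y)" for y n
  have idx[measurable]: "idx n \<in> measurable borel (count_space UNIV)" for n
    unfolding idx_def by measurable
  have uT[simp]: "u y n \<in> space T" for y n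
    by (simp add: u_def)
  have [measurable]: "(\<lambda>y. d (u y n) (u y m)) \<in> borel_measurable borel" for n m
    unfolding u_def
    by (rule measurable_compose_countable[OF _ idx, where f="\<lambda>i y. d (p i) (p (idx m y))"],
        rule measurable_compose_countable[OF _ idx, where f="\<lambda>j y. d (p _) (p j)"]) simp
  have [measurable]: "(\<lambda>y. d (p i) (u y n)) \<in> borel_measurable borel" for n i
    unfolding u_def
    by (rule measurable_compose_countable[OF _ idx, where f="\<lambda>j y. d (p i) (p j)"]) simp
  \<comment> \<open>The Cauchy condition with tolerances \<open>1 / 2 ^ k\<close> uses countable
    quantifiers only, which makes \<open>D\<close> a Borel set.\<close>
  define D where "D = {y. \<forall>k::nat. \<exists>N. \<forall>n\<ge>N. \<forall>m\<ge>N. d (u y n) (u y m) < 1 / 2 ^ k}"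
  have D[measurable]: "D \<in> sets borel"
    unfolding D_def by measurable
  have D_eq: "y \<in> D \<longleftrightarrow> MCauchy (u y)" for y
  proof
    assume "MCauchy (u y)"
    then have "\<exists>N. \<forall>n n'. N \<le> n \<longrightarrow> N \<le> n' \<longrightarrow> d (u y n) (u y n') < 1 / 2 ^ k" for k
      unfolding MCauchy_def by simp
    then show "y \<in> D"
      unfolding D_def by blast
  next
    assume y: "y \<in> D"
    show "MCauchy (u y)"
      unfolding MCauchy_def
    proof (intro conjI allI impI)
      fix \<epsilon> :: real assume "\<epsilon> > 0"
      then obtain k where k: "1 / 2 ^ k < \<epsilon>"
        using real_arch_pow_inv[of \<epsilon> "1/2"] by (auto simp: power_one_over)
      obtain N where "\<forall>n\<ge>N. \<forall>m\<ge>N. d (u y n) (u y m) < 1 / 2 ^ k"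
        using y unfolding D_def by blast
      with k show "\<exists>N. \<forall>n n'. N \<le> n \<longrightarrow> N \<le> n' \<longrightarrow> d (u y n) (u y n') < \<epsilon>"
        by (meson less_trans)
    qed auto
  qed
  \<comment> \<open>Outside \<open>D\<close> the point \<open>p 0\<close> is an arbitrary default;
    completeness supplies the limit on \<open>D\<close>.\<close>
  define g where
    "g y = (if y \<in> D then SOME l. limitin mtopology (u y) l sequentially else p 0)" for y
  have g_lim: "limitin mtopology (u y) (g y) sequentially" if "y \<in> D" for y
    using that compl D_eq[of y] someI_ex[of "\<lambda>l. limitin mtopology (u y) l sequentially"]
    by (auto simp: g_def mcomplete_def)
  have gT: "g y \<in> space T" for y
    using g_lim[of y] limitin_mspace[of "u y" "g y" sequentially] by (cases "y \<in> D") (auto simp: g_def)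
  have g: "g \<in> measurable borel T"
  proof (rule measurable_metric_borelI[OF \<open>Metric_space (space T) d\<close> sets_T dense pT gT])
    fix i
    \<comment> \<open>Freezing the sequence to a constant off \<open>D\<close> makes it converge
      everywhere, so the limit of measurable functions is measurable.\<close>
    have "(\<lambda>y. if y \<in> D then d (p i) (g y) else d (p i) (p 0)) \<in> borel_measurable borel"
    proof (rule borel_measurable_LIMSEQ_real)
      show "(\<lambda>n. if y \<in> D then d (p i) (u y n) else d (p i) (p 0))
              \<longlonglongrightarrow> (if y \<in> D then d (p i) (g y) else d (p i) (p 0))" for y
        using tendsto_mdist[OF g_lim pT, of y i] by auto
    qed measurable
    also have "(\<lambda>y. if y \<in> D then d (p i) (g y) else d (p i) (p 0)) = (\<lambda>y. d (p i) (g y))"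
      by (auto simp: g_def)
    finally show "(\<lambda>y. d (p i) (g y)) \<in> borel_measurable borel" .
  qed
  have "g (f t) = t" if t: "t \<in> space T" for t
  proof -
    \<comment> \<open>By density some ball of radius \<open>1 / 2 ^ n\<close> contains
      \<open>t\<close>, and the digits of \<open>f t\<close> are exactly the membership bits, so the
      search in \<open>idx\<close> succeeds.\<close>
    have dist: "d (u (f t) n) t \<le> (1/2) ^ n" for n
    proof -
      have *: "odd \<lfloor>4 ^ prod_encode (i, n) * f t\<rfloor> \<longleftrightarrow> t \<in> mball (p i) (1 / 2 ^ n)" for i
        unfolding f_def odd_floor_base4_digit by (simp add: ball_def)
      have "\<exists>i. t \<in> mball (p i) (1 / 2 ^ n)"
        using dense[OF t, of "1 / 2 ^ n"] by (auto simp: commute)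
      then have "t \<in> mball (p (idx n (f t))) (1 / 2 ^ n)"
        unfolding idx_def * by (rule LeastI_ex)
      then show ?thesis
        by (auto simp: u_def power_one_over)
    qed
    have "(\<lambda>n. d (u (f t) n) t) \<longlonglongrightarrow> 0"
      by (rule Lim_null_comparison[OF _ LIMSEQ_power_zero[of "1/2"]]) (use dist in auto)
    then have lim: "limitin mtopology (u (f t)) t sequentially"
      using t by (simp add: limitin_metric_dist_null)
    \<comment> \<open>Convergence to \<open>t\<close> gives the Cauchy property, hence membership in
      \<open>D\<close>; uniqueness of limits then yields \<open>g (f t) = t\<close>.\<close>
    then have "f t \<in> D"
      using convergent_imp_MCauchy[OF image_subsetI lim] by (simp add: D_eq)
    from limitin_metric_unique[OF g_lim[OF this] lim] show ?thesis
      by simp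
  qed
  with f g show ?thesis by blast
qed

section \<open>Measurability of partial functions and their sections\<close>

lemma measurable_option_spaceI:
  assumes h: "\<And>x t. x \<in> space X \<Longrightarrow> h x = Some t \<Longrightarrow> t \<in> space Y"
    and m: "\<And>U. U \<in> sets Y \<Longrightarrow> {x \<in> space X. h x \<in> Some ` U} \<in> sets X"
  shows "h \<in> measurable X (option_space Y)"
proof (rule measurableI)
  show "h x \<in> space (option_space Y)" if "x \<in> space X" for x
    using h[OF that] by (cases "h x") (auto simp: space_option_space)
  fix A assume "A \<in> sets (option_space Y)"
  then have "Some -` A \<in> sets Y"
    by (simp add: sets_option_space)
  note sets = m[OF this] m[OF sets.top]
  have "h -` A \<inter> space X = {x \<in> space X. h x \<in> Some ` (Some -` A)} \<union>
      (if None \<in> A then space X - {x \<in> space X. h x \<in> Some ` space Y} else {})"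
  proof (intro set_eqI)
    fix x show "x \<in> h -` A \<inter> space X \<longleftrightarrow> x \<in> {x \<in> space X. h x \<in> Some ` (Some -` A)} \<union>
      (if None \<in> A then space X - {x \<in> space X. h x \<in> Some ` space Y} else {})"
      using h[of x] by (cases "h x") auto
  qed
  also have "\<dots> \<in> sets X"
    by (cases "None \<in> A")
      (simp_all only: if_True if_False sets sets.Un sets.Diff sets.top sets.empty_sets)
  finally show "h -` A \<inter> space X \<in> sets X" .
qed

lemma sets_Collect_Some_image:
  assumes "h \<in> measurable X (option_space Y)" "U \<in> sets Y"
  shows "{x \<in> space X. h x \<in> Some ` U} \<in> sets X"
proof -
  have "Some ` U \<in> sets (option_space Y)"
    using assms(2) sets.sets_into_space[OF assms(2)]
    by (auto simp: sets_option_space inj_vimage_image_eq)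
  from measurable_sets[OF assms(1) this] show ?thesis
    by (simp add: vimage_def Int_def conj_commute)
qed

lemma emeasure_pushforward_partial_lborel:
  assumes "d \<in> measurable (S \<Otimes>\<^sub>M (borel :: real measure)) (option_space T)" "s \<in> space S" "U \<in> sets T"
  shows "emeasure (pushforward_partial lborel T (\<lambda>r. d (s, r))) U = emeasure lborel {r. d (s, r) \<in> Some ` U}"
    and "{r. d (s, r) \<in> Some ` U} \<in> sets borel"
proof -
  have d: "(\<lambda>r. d (s, r)) \<in> measurable lborel (option_space T)"
    using measurable_compose[OF measurable_Pair1' assms(1)] assms(2) by simp
  show "emeasure (pushforward_partial lborel T (\<lambda>r. d (s, r))) U = emeasure lborel {r. d (s, r) \<in> Some ` U}"
    using emeasure_pushforward_partial[OF d assms(3)] by simp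
  show "{r. d (s, r) \<in> Some ` U} \<in> sets borel"
    using sets_Collect_Some_image[OF d assms(3)] by simp
qed

section \<open>Quantile functions of finite measures on the real line\<close>

lemma (in finite_borel_measure) right_continuous_mono_cdf:
  "right_continuous_mono (cdf M) 0 (measure M UNIV)"
  using cdf_lim_at_top unfolding borel_UNIV
  by unfold_locales (auto intro: cdf_nondecreasing cdf_is_right_cont cdf_lim_at_bot monoI)

text \<open>Inverse transform sampling for arbitrary finite mass. The quantile at \<open>r\<close>
  is at most \<open>x\<close> iff \<open>r\<close> is at most \<open>cdf M x\<close>, so both
  measures have the same distribution function. The open interval avoids endpoints where the set
  under \<open>Inf\<close> may be unbounded below or empty; for zero mass it is itself
  empty.\<close>

lemma (in finite_borel_measure)
  shows borel_measurable_quantile: "(\<lambda>r. Inf {y. r \<le> cdf M y}) \<in>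
      borel_measurable (restrict_space lborel {0<..<measure M UNIV})" (is "?q \<in> borel_measurable ?L")
    and distr_quantile: "distr (restrict_space lborel {0<..<measure M UNIV}) borel (\<lambda>r. Inf {y. r \<le> cdf M y}) = M"
proof -
  let ?m = "measure M UNIV"
  interpret right_continuous_mono "cdf M" 0 ?m
    by (rule right_continuous_mono_cdf)
  have sp: "space ?L = {0<..<?m}"
    by (simp add: space_restrict_space)
  interpret L: finite_measure ?L
    by (rule finite_measureI) (simp add: emeasure_restrict_space space_restrict_space)
  show q[measurable]: "?q \<in> borel_measurable ?L"
    using borel_measurable_mono_on_fnc[OF mono_I]
    by (simp cong: measurable_cong_sets sets_restrict_space_cong)
  show "distr ?L borel ?q = M"
  proof (rule cdf_unique')
    show "finite_borel_measure (distr ?L borel ?q)"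
      unfolding finite_borel_measure_def finite_borel_measure_axioms_def
      by (auto intro: L.finite_measure_distr)
    show "finite_borel_measure M" ..
    show "cdf (distr ?L borel ?q) = cdf M"
    proof
      fix x
      have x: "0 \<le> cdf M x" "cdf M x \<le> ?m"
        using cdf_nonneg cdf_bounded[of x] by (auto simp: borel_UNIV)
      have "cdf (distr ?L borel ?q) x = measure lborel {r\<in>{0<..<?m}. r \<le> cdf M x}"
        by (subst cdf_def)
           (auto simp: pseudoinverse[symmetric] measure_distr space_restrict_space measure_restrict_space
                 intro!: arg_cong2[where f="measure"])
      also have "\<dots> = measure lborel {0 <..< cdf M x}"
        unfolding measure_def[of lborel]
      proof (intro arg_cong[where f=enn2real] emeasure_eq_AE)
        \<comment> \<open>The two sets differ at most in the single point
          \<open>cdf M x\<close>.\<close>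
        show "AE r in lborel. r \<in> {r\<in>{0<..<?m}. r \<le> cdf M x} \<longleftrightarrow> r \<in> {0<..<cdf M x}"
          using AE_lborel_singleton[of "cdf M x"] by eventually_elim (use x in auto)
      qed auto
      also have "\<dots> = cdf M x"
        using x by simp
      finally show "cdf (distr ?L borel ?q) x = cdf M x" .
    qed
  qed
qed

section \<open>From kernels to partial functions on \<open>S\<close> times the real line\<close>

text \<open>The bound \<open>c\<close> is uniform in \<open>s\<close> because the masses of a finite
  kernel are bounded; it reserves an interval of fixed length for each summand of an s-finite
  kernel.\<close>

lemma finite_kernel_lborel:
  fixes S :: "'s measure" and T :: "'t measure"
  assumes T: "standard_borel T" and k: "finite_kernel S T k"
  shows "\<exists>d \<in> measurable (S \<Otimes>\<^sub>M (borel :: real measure)) (option_space T). \<exists>c::nat.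
           (\<forall>s\<in>space S. \<forall>r. d (s, r) \<noteq> None \<longrightarrow> 0 < r \<and> r < real c) \<and>
           (\<forall>s\<in>space S. \<forall>U\<in>sets T. emeasure (k s) U = emeasure lborel {r. d (s, r) \<in> Some ` U})"
proof (cases "space T = {}")
  \<comment> \<open>There is no point to retract onto, but the only measurable set is empty, so the
    nowhere defined function works.\<close>
  case True
  then have empty: "U = {}" if "U \<in> sets T" for U
    using sets.sets_into_space[OF that] by simp
  show ?thesis
  proof (intro bexI[of _ "\<lambda>_. None"] exI[of _ 0] conjI ballI)
    show "emeasure (k s) U = emeasure lborel {r. None \<in> Some ` U}" if "U \<in> sets T" for s U
      using empty[OF that] by simp
    show "(\<lambda>_. None) \<in> measurable (S \<Otimes>\<^sub>M borel) (option_space T)"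
      by (rule measurable_option_spaceI) (auto dest: empty)
  qed simp
next
  case False
  obtain f g where f[measurable]: "f \<in> borel_measurable T"
    and g[measurable]: "g \<in> measurable (borel :: real measure) T"
    and gf: "\<And>t. t \<in> space T \<Longrightarrow> g (f t) = t"
    using standard_borel_retract_real[OF T False] by blast
  have sets_k: "sets (k s) = sets T" if "s \<in> space S" for s
    using k that by (simp add: finite_kernel_def is_kernel_def)
  have meas_k: "(\<lambda>s. emeasure (k s) U) \<in> borel_measurable S" if "U \<in> sets T" for U
    using k that by (simp add: finite_kernel_def is_kernel_def)
  have "(SUP s\<in>space S. emeasure (k s) (space T)) < \<infinity>"
    using k by (simp add: finite_kernel_def)
  then obtain c :: nat where c: "(SUP s\<in>space S. emeasure (k s) (space T)) < of_nat c"
    using ennreal_Ex_less_of_nat by auto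
  have k_less: "emeasure (k s) (space T) < of_nat c" if "s \<in> space S" for s
    using c that by (meson SUP_upper le_less_trans)
  define \<nu> where "\<nu> s = distr (k s) borel f" for s
  define F where "F s y = cdf (\<nu> s) y" for s y
  define m where "m s = measure (\<nu> s) UNIV" for s
  define q where "q s r = Inf {y. r \<le> F s y}" for s r
  have f_k: "f \<in> borel_measurable (k s)" if "s \<in> space S" for s
    by (subst measurable_cong_sets[OF sets_k[OF that] refl]) (rule f)
  have \<nu>: "finite_borel_measure (\<nu> s)" if "s \<in> space S" for s
  proof -
    have "finite_measure (k s)"
      using k_less[OF that] sets_eq_imp_space_eq[OF sets_k[OF that]]
      by (intro finite_measureI) auto
    then show ?thesis
      using f_k[OF that]
      by (simp add: \<nu>_def finite_borel_measure_def finite_borel_measure_axioms_def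
          finite_measure.finite_measure_distr)
  qed
  have measure_\<nu>: "measure (\<nu> s) B = enn2real (emeasure (k s) (f -` B \<inter> space T))"
    if "s \<in> space S" "B \<in> sets borel" for s B
    using that f_k[OF that(1)] sets_eq_imp_space_eq[OF sets_k[OF that(1)]]
    by (simp add: measure_def \<nu>_def emeasure_distr)
  have "(\<lambda>s. measure (\<nu> s) B) \<in> borel_measurable S" if "B \<in> sets borel" for B
  proof -
    have "(\<lambda>s. enn2real (emeasure (k s) (f -` B \<inter> space T))) \<in> borel_measurable S"
      by (intro borel_measurable_enn2real meas_k measurable_sets[OF f that])
    then show ?thesis
      by (rule measurable_cong[THEN iffD2, rotated]) (simp add: measure_\<nu> that)
  qed
  then have [measurable]: "(\<lambda>s. F s y) \<in> borel_measurable S" "m \<in> borel_measurable S" for y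
    by (simp_all add: F_def cdf_def m_def[abs_def])
  have m_less: "m s < real c" if s: "s \<in> space S" for s
  proof -
    have "m s = enn2real (emeasure (k s) (space T))"
      using measure_\<nu>[OF s, of UNIV] by (simp add: m_def)
    moreover obtain x where x: "0 \<le> x" "emeasure (k s) (space T) = ennreal x"
      using k_less[OF s] by (cases "emeasure (k s) (space T)") auto
    moreover have "ennreal x < ennreal (real c)"
      using k_less[OF s] unfolding x(2) ennreal_of_nat_eq_real_of_nat .
    ultimately show ?thesis
      by (simp add: ennreal_less_iff)
  qed
  have q_le: "q s r \<le> y \<longleftrightarrow> r \<le> F s y" if "s \<in> space S" "0 < r" "r < m s" for s r y
  proof -
    interpret finite_borel_measure "\<nu> s" by (rule \<nu>) fact
    interpret right_continuous_mono "cdf (\<nu> s)" 0 "m s"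
      unfolding m_def by (rule right_continuous_mono_cdf)
    show ?thesis
      unfolding q_def F_def by (rule pseudoinverse[OF that(2,3), symmetric])
  qed
  \<comment> \<open>The region under the graph of the total mass \<open>m\<close>: the domain of
    definition of \<open>d\<close>.\<close>
  define E where "E = {x \<in> space (S \<Otimes>\<^sub>M borel). 0 < snd x \<and> snd x < m (fst x)}"
  have E[measurable]: "E \<in> sets (S \<Otimes>\<^sub>M borel)"
    unfolding E_def by measurable
  \<comment> \<open>Joint measurability in both arguments: by \<open>q_le\<close>, a sublevel set of
    the quantile is given by \<open>r \<le> F s y\<close> with \<open>y\<close> fixed, which needs
    only measurability of \<open>F\<close> in \<open>s\<close>. The value 0 off \<open>E\<close> is
    a default.\<close>
  have q[measurable]: "(\<lambda>x. if x \<in> E then q (fst x) (snd x) else 0) \<in> borel_measurable (S \<Otimes>\<^sub>M borel)"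
    unfolding borel_measurable_iff_le
  proof
    fix y
    have "{x \<in> space (S \<Otimes>\<^sub>M borel). (if x \<in> E then q (fst x) (snd x) else 0) \<le> y} =
          {x \<in> space (S \<Otimes>\<^sub>M borel). if x \<in> E then snd x \<le> F (fst x) y else 0 \<le> y}"
      using q_le by (auto simp: E_def space_pair_measure)
    also have "\<dots> \<in> sets (S \<Otimes>\<^sub>M borel)"
      by measurable
    finally show "{x \<in> space (S \<Otimes>\<^sub>M borel). (if x \<in> E then q (fst x) (snd x) else 0) \<le> y} \<in> sets (S \<Otimes>\<^sub>M borel)" .
  qed
  define d where "d x = (if x \<in> E then Some (g (q (fst x) (snd x))) else None)" for x
  have gT: "g y \<in> space T" for y
    using measurable_space[OF g] by simp
  have "d \<in> measurable (S \<Otimes>\<^sub>M borel) (option_space T)"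
  proof (rule measurable_option_spaceI)
    fix U assume [measurable]: "U \<in> sets T"
    have "{x \<in> space (S \<Otimes>\<^sub>M borel). d x \<in> Some ` U} =
          {x \<in> space (S \<Otimes>\<^sub>M borel). x \<in> E \<and> g (if x \<in> E then q (fst x) (snd x) else 0) \<in> U}"
      by (auto simp: d_def)
    also have "\<dots> \<in> sets (S \<Otimes>\<^sub>M borel)"
      by measurable
    finally show "{x \<in> space (S \<Otimes>\<^sub>M borel). d x \<in> Some ` U} \<in> sets (S \<Otimes>\<^sub>M borel)" .
  qed (auto simp: d_def gT split: if_splits)
  moreover have "0 < r \<and> r < real c" if "s \<in> space S" "d (s, r) \<noteq> None" for s r
    using that m_less[of s] by (auto simp: d_def E_def split: if_splits)
  moreover have "emeasure (k s) U = emeasure lborel {r. d (s, r) \<in> Some ` U}"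
    if s: "s \<in> space S" and U[measurable]: "U \<in> sets T" for s U
  proof -
    let ?L = "restrict_space lborel {0<..<m s}"
    interpret finite_borel_measure "\<nu> s" by (rule \<nu>) fact
    have "q s \<in> borel_measurable ?L"
      using borel_measurable_quantile by (simp add: q_def[abs_def] F_def m_def)
    have gU: "g -` U \<in> sets borel"
      using measurable_sets[OF g U] by simp
    \<comment> \<open>Since \<open>g\<close> inverts \<open>f\<close> on \<open>T\<close>, pulling
      \<open>U\<close> back along \<open>g\<close> and then along \<open>f\<close> returns
      \<open>U\<close>.\<close>
    have "emeasure (k s) U = emeasure (k s) (f -` (g -` U) \<inter> space T)"
      using sets.sets_into_space[OF U] gf by (intro arg_cong[where f="emeasure (k s)"]) auto
    also have "\<dots> = emeasure (\<nu> s) (g -` U)"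
      using gU f_k[OF s] sets_eq_imp_space_eq[OF sets_k[OF s]] by (simp add: \<nu>_def emeasure_distr)
    also have "\<dots> = emeasure (distr ?L borel (q s)) (g -` U)"
      using distr_quantile by (simp add: q_def[abs_def] F_def m_def)
    also have "\<dots> = emeasure ?L (q s -` (g -` U) \<inter> space ?L)"
      by (intro emeasure_distr gU) fact
    also have "\<dots> = emeasure lborel (q s -` (g -` U) \<inter> space ?L)"
      by (simp add: emeasure_restrict_space space_restrict_space)
    also have "q s -` (g -` U) \<inter> space ?L = {r. d (s, r) \<in> Some ` U}"
      using s by (auto simp: d_def E_def space_restrict_space space_pair_measure)
    finally show ?thesis .
  qed
  ultimately show ?thesis
    by blast
qed

text \<open>Summand \<open>i\<close> is moved to the interval from \<open>a i\<close> to
  \<open>a (Suc i)\<close>. As the offsets do not depend on \<open>s\<close>, the active summand is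
  a measurable function of \<open>r\<close> alone. Translation invariance preserves the mass of each
  piece, and disjointness turns the sum of measures into the measure of a union.\<close>

lemma s_finite_kernel_lborel:
  fixes S :: "'s measure" and T :: "'t measure"
  assumes T: "standard_borel T" and \<sigma>: "s_finite_kernel S T \<sigma>"
  shows "\<exists>d \<in> measurable (S \<Otimes>\<^sub>M (borel :: real measure)) (option_space T).
           \<forall>s\<in>space S. \<sigma> s = pushforward_partial lborel T (\<lambda>r. d (s, r))"
proof -
  obtain k where k: "\<And>i. finite_kernel S T (k i)"
    and sum_k: "\<And>s U. s \<in> space S \<Longrightarrow> U \<in> sets T \<Longrightarrow> emeasure (\<sigma> s) U = (\<Sum>i. emeasure (k i s) U)"
    using \<sigma> unfolding s_finite_kernel_def by blast
  have "\<forall>i. \<exists>d c. d \<in> measurable (S \<Otimes>\<^sub>M (borel :: real measure)) (option_space T) \<and>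
           (\<forall>s\<in>space S. \<forall>r. d (s, r) \<noteq> None \<longrightarrow> 0 < r \<and> r < real c) \<and>
           (\<forall>s\<in>space S. \<forall>U\<in>sets T. emeasure (k i s) U = emeasure lborel {r. d (s, r) \<in> Some ` U})"
    using finite_kernel_lborel[OF T k] by blast
  then obtain d c where
      d: "\<And>i. d i \<in> measurable (S \<Otimes>\<^sub>M (borel :: real measure)) (option_space T)"
    and dom: "\<And>i s r. s \<in> space S \<Longrightarrow> d i (s, r) \<noteq> None \<Longrightarrow> 0 < r \<and> r < real (c i)"
    and em: "\<And>i s U. s \<in> space S \<Longrightarrow> U \<in> sets T \<Longrightarrow>
               emeasure (k i s) U = emeasure lborel {r. d i (s, r) \<in> Some ` U}"
    by metis
  define a where "a i = real (\<Sum>j<i. c j)" for i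
  \<comment> \<open>For negative \<open>r\<close> this is 0, and for \<open>r\<close> beyond all
    offsets it is unspecified; in both cases \<open>dom\<close> makes \<open>D (s, r)\<close>
    undefined for \<open>s\<close> in \<open>S\<close>. Intervals of length zero are
    skipped.\<close>
  define idx where "idx r = (LEAST i. r < a (Suc i))" for r
  define D where "D x = d (idx (snd x)) (fst x, snd x - a (idx (snd x)))" for x
  have [measurable]: "idx \<in> measurable borel (count_space UNIV)"
    unfolding idx_def by measurable
  have mono_a: "a i \<le> a j" if "i \<le> j" for i j
    unfolding a_def using that by (auto intro!: sum_mono2)
  have idx: "idx r = i" if "a i \<le> r" "r < a (Suc i)" for i r
    unfolding idx_def
  proof (rule Least_equality)
    fix j assume "r < a (Suc j)"
    then show "i \<le> j"
      using that(1) mono_a[of "Suc j" i] by (cases "i \<le> j") auto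
  qed fact
  have D_Some: "D (s, r) = Some t \<longleftrightarrow> (\<exists>i. d i (s, r - a i) = Some t)" if "s \<in> space S" for s r t
  proof
    assume "\<exists>i. d i (s, r - a i) = Some t"
    then obtain i where i: "d i (s, r - a i) = Some t" by auto
    then have "0 < r - a i" "r - a i < real (c i)"
      using dom[OF that, of i "r - a i"] by auto
    then have "idx r = i"
      by (intro idx) (auto simp: a_def)
    with i show "D (s, r) = Some t" by (simp add: D_def)
  qed (auto simp: D_def)
  have disj: "i = j" if "s \<in> space S" "d i (s, r - a i) \<noteq> None" "d j (s, r - a j) \<noteq> None" for s r i j
  proof -
    have "idx r = i" "idx r = j"
      using dom[OF that(1,2)] dom[OF that(1,3)] by (auto intro!: idx simp: a_def)
    then show ?thesis by simp
  qed
  have D: "D \<in> measurable (S \<Otimes>\<^sub>M borel) (option_space T)"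
    unfolding D_def
  \<comment> \<open>Since \<open>idx\<close> takes countably many values, the summand may be
    fixed.\<close>
  proof (rule measurable_compose_countable)
    show "(\<lambda>x. d i (fst x, snd x - a i)) \<in> measurable (S \<Otimes>\<^sub>M borel) (option_space T)" for i
      by (rule measurable_compose[OF _ d]) measurable
  qed measurable
  moreover have "\<sigma> s = pushforward_partial lborel T (\<lambda>r. D (s, r))" if s: "s \<in> space S" for s
  proof (rule measure_eqI)
    show "sets (\<sigma> s) = sets (pushforward_partial lborel T (\<lambda>r. D (s, r)))"
      using \<sigma> s by (simp add: s_finite_kernel_def is_kernel_def)
    fix U assume "U \<in> sets (\<sigma> s)"
    then have U: "U \<in> sets T"
      using \<sigma> s by (simp add: s_finite_kernel_def is_kernel_def)
    let ?A = "\<lambda>i. {r. d i (s, r) \<in> Some ` U}"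
    let ?B = "\<lambda>i. {r. d i (s, r - a i) \<in> Some ` U}"
    have A: "?A i \<in> sets borel" for i
      by (rule emeasure_pushforward_partial_lborel[OF d s U])
    have B: "?B i = (\<lambda>r. r - a i) -` ?A i \<inter> space lborel" for i
      by auto
    have sets_B: "?B i \<in> sets lborel" for i
      unfolding B by (rule measurable_sets[where A=borel]) (use A in simp_all)
    have minus_shift: "(\<lambda>r. r - a i) = (+) (- a i)" for i
      by auto
    have shift: "emeasure lborel (?A i) = emeasure lborel (?B i)" for i
    proof -
      have "emeasure lborel (?A i) = emeasure (distr lborel borel (\<lambda>r. r - a i)) (?A i)"
        using lborel_distr_plus[of "- a i"] by (simp add: minus_shift)
      also have "\<dots> = emeasure lborel (?B i)"
        unfolding B by (rule emeasure_distr) (use A in simp_all)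
      finally show ?thesis .
    qed
    have "emeasure (\<sigma> s) U = (\<Sum>i. emeasure lborel (?B i))"
      by (simp add: sum_k em s U shift)
    also have "\<dots> = emeasure lborel (\<Union>i. ?B i)"
    proof (rule suminf_emeasure)
      show "range ?B \<subseteq> sets lborel"
        using sets_B by auto
      show "disjoint_family ?B"
        using disj[OF s] by (fastforce simp: disjoint_family_on_def)
    qed
    also have "(\<Union>i. ?B i) = {r. D (s, r) \<in> Some ` U}"
      by (simp add: set_eq_iff image_iff D_Some[OF s]) blast
    also have "emeasure lborel \<dots> = emeasure (pushforward_partial lborel T (\<lambda>r. D (s, r))) U"
      by (rule emeasure_pushforward_partial_lborel(1)[OF D s U, symmetric])
    finally show "emeasure (\<sigma> s) U = emeasure (pushforward_partial lborel T (\<lambda>r. D (s, r))) U" .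
  qed
  ultimately show ?thesis by blast
qed

section \<open>From partial functions back to s-finite kernels\<close>

text \<open>Restricting \<open>d\<close> to the piece \<open>A i\<close>, which lies between
  \<open>- (i + 1)\<close> and \<open>i + 1\<close>, bounds the mass by \<open>2 * i + 2\<close>
  uniformly in \<open>s\<close>. The pieces partition the line, so the restrictions sum to the whole
  pushforward.\<close>

lemma s_finite_kernel_pushforward_partial_lborel:
  fixes S :: "'s measure" and T :: "'t measure"
  assumes \<sigma>: "is_kernel S T \<sigma>"
    and d[measurable]: "d \<in> measurable (S \<Otimes>\<^sub>M (borel :: real measure)) (option_space T)"
    and eq: "\<And>s. s \<in> space S \<Longrightarrow> \<sigma> s = pushforward_partial lborel T (\<lambda>r. d (s, r))"
  shows "s_finite_kernel S T \<sigma>"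
proof -
  \<comment> \<open>The piece is \<open>i \<le> \<bar>r\<bar> < i + 1\<close>; as fibres of one
    function the pieces are disjoint and cover the line.\<close>
  define A where "A i = {r::real. nat \<lfloor>\<bar>r\<bar>\<rfloor> = i}" for i
  define D where "D i x = (if snd x \<in> A i then d x else None)" for i x
  define k where "k i s = pushforward_partial lborel T (\<lambda>r. D i (s, r))" for i s
  have A[measurable]: "A i \<in> sets borel" for i
    unfolding A_def by measurable
  have D: "D i \<in> measurable (S \<Otimes>\<^sub>M borel) (option_space T)" for i
    unfolding D_def by (rule measurable_If) (auto intro!: measurable_option_spaceI)
  have em: "emeasure (k i s) U = emeasure lborel {r. D i (s, r) \<in> Some ` U}"
    if "s \<in> space S" "U \<in> sets T" for i s U
    unfolding k_def by (rule emeasure_pushforward_partial_lborel(1)[OF D that])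
  have "emeasure (k i s) (space T) \<le> of_nat (2 * i + 2)" if s: "s \<in> space S" for i s
  proof -
    have "emeasure (k i s) (space T) \<le> emeasure lborel {- real (i + 1)..real (i + 1)}"
      unfolding em[OF s sets.top]
      by (rule emeasure_mono) (auto simp: D_def A_def split: if_splits, linarith+)
    also have "\<dots> = of_nat (2 * i + 2)"
      unfolding ennreal_of_nat_eq_real_of_nat by simp
    finally show ?thesis .
  qed
  then have "(SUP s\<in>space S. emeasure (k i s) (space T)) \<le> of_nat (2 * i + 2)" for i
    by (rule SUP_least)
  then have fin: "(SUP s\<in>space S. emeasure (k i s) (space T)) < \<infinity>" for i
    unfolding infinity_ennreal_def by (rule le_less_trans[OF _ of_nat_less_top])
  have "is_kernel S T (k i)" for i
    unfolding is_kernel_def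
  proof (intro conjI ballI)
    fix U assume U: "U \<in> sets T"
    \<comment> \<open>Measurability in \<open>s\<close> is that of the measures of sections of a
      product-measurable set, available because Lebesgue measure is sigma-finite.\<close>
    let ?Q = "{x \<in> space (S \<Otimes>\<^sub>M borel). D i x \<in> Some ` U}"
    have "?Q \<in> sets (S \<Otimes>\<^sub>M lborel)"
      using sets_Collect_Some_image[OF D U] by (simp cong: sets_pair_measure_cong)
    then have "(\<lambda>s. emeasure lborel (Pair s -` ?Q)) \<in> borel_measurable S"
      by (rule lborel.measurable_emeasure_Pair)
    then show "(\<lambda>s. emeasure (k i s) U) \<in> borel_measurable S"
      by (rule measurable_cong[THEN iffD1, rotated]) (simp add: em U vimage_def space_pair_measure)
  qed (simp add: k_def)
  with fin have "finite_kernel S T (k i)" for i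
    by (simp add: finite_kernel_def)
  moreover have "emeasure (\<sigma> s) U = (\<Sum>i. emeasure (k i s) U)" if s: "s \<in> space S" and U: "U \<in> sets T" for s U
  proof -
    let ?B = "\<lambda>i. {r. D i (s, r) \<in> Some ` U}"
    have "(\<Sum>i. emeasure (k i s) U) = (\<Sum>i. emeasure lborel (?B i))"
      by (simp add: em s U)
    also have "\<dots> = emeasure lborel (\<Union>i. ?B i)"
    proof (rule suminf_emeasure)
      show "range ?B \<subseteq> sets lborel"
        using emeasure_pushforward_partial_lborel(2)[OF D s U] by auto
      show "disjoint_family ?B"
        by (auto simp: disjoint_family_on_def D_def A_def split: if_splits)
    qed
    also have "(\<Union>i. ?B i) = {r. d (s, r) \<in> Some ` U}"
      by (auto simp: D_def A_def split: if_splits)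
    also have "emeasure lborel \<dots> = emeasure (\<sigma> s) U"
      by (simp add: eq s emeasure_pushforward_partial_lborel(1)[OF d s U])
    finally show ?thesis by simp
  qed
  ultimately show ?thesis
    unfolding s_finite_kernel_def using \<sigma> by blast
qed

theorem theorem16:
  fixes S :: "'s measure" and T :: "'t measure"
  assumes "standard_borel T"
  shows "(\<forall>\<sigma> :: 's \<Rightarrow> 't measure. s_finite_kernel S T \<sigma> \<longrightarrow>
            (\<exists>d \<in> measurable (S \<Otimes>\<^sub>M (borel :: real measure)) (option_space T).
               \<forall>s\<in>space S. \<sigma> s = pushforward_partial lborel T (\<lambda>r. d (s, r)))) \<and>
         (\<forall>\<sigma> :: 's \<Rightarrow> 't measure. is_kernel S T \<sigma> \<longrightarrow>
            (\<exists>d \<in> measurable (S \<Otimes>\<^sub>M (borel :: real measure)) (option_space T).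
               \<forall>s\<in>space S. \<sigma> s = pushforward_partial lborel T (\<lambda>r. d (s, r))) \<longrightarrow>
            s_finite_kernel S T \<sigma>)"
  using s_finite_kernel_lborel[OF assms] s_finite_kernel_pushforward_partial_lborel
  by blast

end
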